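(* Let $\kappa^->\kappa^+$ and let $\rho^-,\rho^+\in[0,1]$ be given such that $\rho^-<\rho^+\le\hat\rho$ and $f(\kappa^-,\rho^-)=f(\kappa^+,\rho^+)=:\bar f$. Then there exists exactly one stationary monotone profile $Q$, i.e. exactly one monotone function $Q:\mathbb{R}\setminus\{0\}\to[0,1]$ with $$Q(x)\,\kappa(x)\,v(A(Q;x))=\bar f\qquad\text{for all } x\ne0,$$ which is monotone increasing on $x<0$ and satisfies $$Q(x)\equiv\rho^+\quad(x>0),\qquad\text{and}\qquad \lim_{x\to-\infty}Q(x)=\rho^- .$$
   Context: Fix $h>0$ and $\kappa^-,\kappa^+>0$, and let $\kappa(x)=\kappa^-$ for $x<0$ and $\kappa(x)=\kappa^+$ for $x>0$. The function $v\in C^2$ satisfies $v(0)=1$, $v(1)=0$, $v'(\rho)<0$ and $v''(\rho)\le 0$ for all $\rho\in[0,1]$. The weight $w\ge 0$ is defined on $x\ge0$, is continuous and bounded on $x>0$, and satisfies $\int_0^h w(x)\,dx=1$, $w(x)=0$ for all $x\ge h$, and $w'(x)<0$ for all $x\in(0,h)$. Put $A(Q;x)=\int_x^{x+h}Q(y)w(y-x)\,dy=\int_0^hQ(x+s)w(s)\,ds$ and $f(\kappa,\rho)=\kappa\,\rho\,v(\rho)$. The number $\hat\rho\in(0,1)$ is the unique point (independent of $\kappa>0$) with $f_\rho(\kappa,\hat\rho)=0$, $f_\rho(\kappa,\rho)>0$ for $\rho<\hat\rho$ and $f_\rho(\kappa,\rho)<0$ for $\rho>\hat\rho$. A stationary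 profile is a stationary solution of $\rho_t+[\rho(t,x)\kappa(x)v(\int_x^{x+h}\rho(t,y)w(y-x)\,dy)]_x=0$; since $A(Q;\cdot)$ is continuous, its traces at $0$ satisfy the connecting condition $\kappa^-Q(0-)=\kappa^+Q(0+)$. *)

theory Defs
  imports "HOL-Analysis.Analysis"
begin

text \<open>The value at \<open>x = 0\<close> is a convention only; it is never used.\<close>

definition kappa :: "real \<Rightarrow> real \<Rightarrow> real \<Rightarrow> real" where
  "kappa \<kappa>m \<kappa>p x = (if x < 0 then \<kappa>m else \<kappa>p)"

definition flux :: "(real \<Rightarrow> real) \<Rightarrow> real \<Rightarrow> real \<Rightarrow> real" where
  "flux v \<kappa> \<rho> = \<kappa> * \<rho> * v \<rho>"

definition avg :: "real \<Rightarrow> (real \<Rightarrow> real) \<Rightarrow> (real \<Rightarrow> real) \<Rightarrow> real \<Rightarrow> real" where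
  "avg h w Q x = integral {x..x + h} (\<lambda>y. Q y * w (y - x))"

text \<open>Derivatives at the endpoints of \<open>[0,1]\<close> are one-sided.\<close>

definition C2_unit :: "(real \<Rightarrow> real) \<Rightarrow> (real \<Rightarrow> real) \<Rightarrow> (real \<Rightarrow> real) \<Rightarrow> bool" where
  "C2_unit v v' v'' \<longleftrightarrow>
     (\<forall>\<rho>\<in>{0..1}. (v has_real_derivative v' \<rho>) (at \<rho> within {0..1})) \<and>
     (\<forall>\<rho>\<in>{0..1}. (v' has_real_derivative v'' \<rho>) (at \<rho> within {0..1})) \<and>
     continuous_on {0..1} v''"

definition flux_critical_point :: "(real \<Rightarrow> real) \<Rightarrow> real \<Rightarrow> bool" where
  "flux_critical_point v r \<longleftrightarrow>
     0 < r \<and> r < 1 \<and>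
     (\<forall>\<kappa>>0. \<exists>f'.
        (\<forall>\<rho>\<in>{0..1}. (flux v \<kappa> has_real_derivative f' \<rho>) (at \<rho> within {0..1})) \<and>
        f' r = 0 \<and> (\<forall>\<rho>\<in>{0..<r}. f' \<rho> > 0) \<and> (\<forall>\<rho>\<in>{r<..1}. f' \<rho> < 0))"

text \<open>
  Functions on \<open>\<real>\<close> without \<open>0\<close> are represented extensionally, so that equality of two
  profiles means agreement at all \<open>x \<noteq> 0\<close>.
\<close>

definition stationary_monotone_profile ::
  "real \<Rightarrow> real \<Rightarrow> real \<Rightarrow> (real \<Rightarrow> real) \<Rightarrow> (real \<Rightarrow> real) \<Rightarrow> real \<Rightarrow> (real \<Rightarrow> real) \<Rightarrow> bool" where
  "stationary_monotone_profile h \<kappa>m \<kappa>p v w fbar Q \<longleftrightarrow>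
     Q \<in> (- {0}) \<rightarrow>\<^sub>E {0..1} \<and>
     (mono_on (- {0}) Q \<or> antimono_on (- {0}) Q) \<and>
     (\<forall>x. x \<noteq> 0 \<longrightarrow> Q x * kappa \<kappa>m \<kappa>p x * v (avg h w Q x) = fbar)"

end

theory Submission
  imports Defs
begin

text \<open>
  Since \<open>v > 0\<close> on the range that matters, the profile equation on \<open>x < 0\<close> can be solved for the
  value at \<open>x\<close>: it says \<open>Q x = g (A(Q;x))\<close> with \<open>g y = fbar / (\<kappa>m * v y)\<close>. As \<open>v\<close> is decreasing
  and \<open>C\<^sup>2\<close>, the function \<open>g\<close> is increasing and Lipschitz on \<open>[\<rho>m, \<rho>p]\<close>. The two flux equations
  give \<open>g \<rho>m = \<rho>m\<close> and \<open>g \<rho>p = \<rho>p * \<kappa>p / \<kappa>m \<le> \<rho>p\<close>, so \<open>g\<close> maps \<open>[\<rho>m, \<rho>p]\<close> into itself; and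
  because the flux is strictly increasing below \<open>\<rho>hat\<close>, \<open>\<rho>m\<close> is the only fixed point of \<open>g\<close> there.
  On \<open>x > 0\<close> the profile is prescribed to be \<open>\<rho>p\<close>; the equation holds there because the average looks
  only to the right and so equals \<open>\<rho>p\<close>.

  Existence (\<open>ex_increasing_solution\<close>). The operator \<open>T Q = g (A(Q;.))\<close> on \<open>x < 0\<close>, \<open>T Q = \<rho>p\<close> on
  \<open>x \<ge> 0\<close>, preserves the increasing functions with values in \<open>[\<rho>m, \<rho>p]\<close> and is monotone for the
  pointwise order. Suprema of increasing functions are increasing, so the Knaster--Tarski argument
  applies: the supremum of all \<open>P\<close> with \<open>P \<le> T P\<close> is a fixed point. This way
  no passage to the limit under the integral occurs.

  Uniqueness (\<open>increasing_solution_unique\<close>). The average is a Volterra operator: with bounded \<open>w\<close>,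
  two solutions that agree on \<open>x \<ge> 0\<close> satisfy \<open>\<bar>P - R\<bar>(x) \<le> C * \<integral>\<bar>P - R\<bar>\<close> over \<open>[x, x + h]\<close>. In the
  supremum norm with weight \<open>exp (c * x)\<close> and \<open>c\<close> large this is a contraction, which forces \<open>P = R\<close>.

  Limit (\<open>increasing_solution_tendsto_at_bot\<close>). An increasing solution has a limit \<open>l\<close> at \<open>-\<infinity>\<close>. Its
  average, squeezed between \<open>P x\<close> and \<open>P (x + h)\<close>, has the same limit, so \<open>g l = l\<close> and \<open>l = \<rho>m\<close>.

  Conversely every profile of the theorem is such an increasing solution: it cannot be decreasing,
  since its limit \<open>\<rho>m\<close> at \<open>-\<infinity>\<close> lies below its value \<open>\<rho>p\<close> on \<open>x > 0\<close>, and being increasing it takes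
  values in \<open>[\<rho>m, \<rho>p]\<close>.
\<close>

section \<open>Averages of increasing functions\<close>

locale averaging_kernel =
  fixes h W :: real and w :: "real \<Rightarrow> real"
  assumes h_pos: "h > 0"
    and w_nonneg: "\<And>s. 0 \<le> s \<Longrightarrow> 0 \<le> w s"
    and w_le: "\<And>s. 0 \<le> s \<Longrightarrow> w s \<le> W"
    and w_mass: "(w has_integral 1) {0..h}"
begin

lemma avg_eq_shifted_integral: "avg h w P x = integral {0..h} (\<lambda>s. P (x + s) * w s)"
  using integral_shift_real_ivl[of x x "x + h" "\<lambda>y. P y * w (y - x)"]
  by (simp add: avg_def add.commute)

text \<open>
  The second mean value theorem for integrals delivers, besides the mean value formula, the
  integrability of an increasing function times an integrable one.
\<close>

lemma integrable_mono_times_kernel: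
  assumes "mono P"
  shows "(\<lambda>s. P (x + s) * w s) integrable_on {0..h}"
proof -
  obtain c where "((\<lambda>s. P (x + s) * w s) has_integral
      (P (x + 0) * integral {0..c} w + P (x + h) * integral {c..h} w)) {0..h}"
  proof (rule second_mean_value_theorem_full[of w 0 h "\<lambda>s. P (x + s)"])
    show "w integrable_on {0..h}" using w_mass by blast
    show "P (x + s) \<le> P (x + t)" if "s \<le> t" for s t
      using assms that by (simp add: mono_def)
  qed (use h_pos in auto)
  then show ?thesis by blast
qed

text \<open>
  Allowing different base points \<open>x\<close> and \<open>y\<close> covers two facts at once: the average depends
  monotonically on the function (\<open>x = y\<close>), and the average of an increasing function is increasing
  (\<open>P = R\<close>).
\<close>

lemma avg_mono:
  assumes "mono P" "mono R" "\<And>s. 0 \<le> s \<Longrightarrow> s \<le> h \<Longrightarrow> P (x + s) \<le> R (y + s)"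
  shows "avg h w P x \<le> avg h w R y"
  unfolding avg_eq_shifted_integral
  by (intro integral_le integrable_mono_times_kernel assms(1,2))
    (auto intro!: mult_right_mono assms(3) w_nonneg)

lemma avg_const: "avg h w (\<lambda>_. c) x = c"
  unfolding avg_eq_shifted_integral
  using integral_unique[OF has_integral_mult_right[OF w_mass, of c]] by simp

lemma avg_between_endpoint_values:
  assumes "mono P"
  shows "P x \<le> avg h w P x" "avg h w P x \<le> P (x + h)"
proof -
  have const: "mono (\<lambda>_::real. c)" for c :: real
    by (simp add: mono_def)
  show "P x \<le> avg h w P x"
    using avg_mono[OF const assms, of "P x" x x] assms by (auto simp: avg_const mono_def)
  show "avg h w P x \<le> P (x + h)"
    using avg_mono[OF assms const, of x "P (x + h)" x] assms by (auto simp: avg_const mono_def)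
qed

lemma avg_in_range:
  assumes "mono P" "\<And>y. P y \<in> {a..b}"
  shows "avg h w P x \<in> {a..b}"
  using avg_between_endpoint_values[OF assms(1), of x] assms(2)[of x] assms(2)[of "x + h"]
  by simp

text \<open>
  This is the source of the contraction: the average looks only to the right of \<open>x\<close>, where
  \<open>exp (- c * y)\<close> is smaller, and integrating this function over \<open>y \<ge> x\<close> gains a factor \<open>1 / c\<close>.
\<close>

lemma avg_diff_le_exponential:
  assumes mono: "mono P" "mono R" and "c > 0" and "M \<ge> 0"
    and bound: "\<And>y. \<bar>P y - R y\<bar> \<le> M * exp (- c * y)"
  shows "\<bar>avg h w P x - avg h w R x\<bar> \<le> W / c * (M * exp (- c * x))"
proof -
  let ?f = "\<lambda>s. P (x + s) * w s - R (x + s) * w s"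
  let ?g = "\<lambda>s. W * (M * exp (- c * (x + s)))"
  let ?G = "\<lambda>s. - (W / c * (M * exp (- c * (x + s))))"
  have W: "0 \<le> W" using w_nonneg[of 0] w_le[of 0] by simp
  have g: "(?g has_integral ?G h - ?G 0) {0..h}"
    using h_pos \<open>c > 0\<close>
    by (intro fundamental_theorem_of_calculus)
      (auto simp flip: has_real_derivative_iff_has_vector_derivative intro!: derivative_eq_intros)
  have int: "?f integrable_on {0..h}"
    by (intro integrable_diff integrable_mono_times_kernel mono)
  have "avg h w P x - avg h w R x = integral {0..h} ?f"
    unfolding avg_eq_shifted_integral
    by (simp add: integral_diff integrable_mono_times_kernel mono)
  also have "norm (integral {0..h} ?f) \<le> integral {0..h} ?g"
  proof (rule integral_norm_bound_integral[OF int])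
    show "?g integrable_on {0..h}" using g by blast
    fix s assume s: "s \<in> {0..h}"
    have "\<bar>P (x + s) - R (x + s)\<bar> * w s \<le> (M * exp (- c * (x + s))) * W"
      using s bound[of "x + s"] \<open>M \<ge> 0\<close> by (intro mult_mono w_le) (auto intro: w_nonneg)
    moreover have "norm (?f s) = \<bar>P (x + s) - R (x + s)\<bar> * w s"
      using s w_nonneg[of s] by (simp add: abs_mult flip: left_diff_distrib)
    ultimately show "norm (?f s) \<le> ?g s" by (simp add: mult.commute)
  qed
  also have "\<dots> = ?G h - ?G 0" using g by (rule integral_unique)
  also have "\<dots> \<le> W / c * (M * exp (- c * x))"
    using W \<open>M \<ge> 0\<close> \<open>c > 0\<close> by simp
  finally show ?thesis by simp
qed

end

section \<open>Increasing solutions of the profile equation\<close>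

text \<open>
  These are the candidate profiles, extended to \<open>x = 0\<close> by the value \<open>b\<close> taken on the right. Being
  increasing on the whole line, they need no special treatment of the origin.
\<close>

definition increasing_solution ::
  "real \<Rightarrow> (real \<Rightarrow> real) \<Rightarrow> (real \<Rightarrow> real) \<Rightarrow> real \<Rightarrow> real \<Rightarrow> (real \<Rightarrow> real) \<Rightarrow> bool" where
  "increasing_solution h w g a b P \<longleftrightarrow>
     mono P \<and> (\<forall>x. P x \<in> {a..b}) \<and> (\<forall>x\<ge>0. P x = b) \<and> (\<forall>x<0. P x = g (avg h w P x))"

context averaging_kernel
begin

text \<open>
  Knaster--Tarski on the increasing functions \<open>P\<close> with values in \<open>{a..b}\<close> and \<open>P = b\<close> on \<open>x \<ge> 0\<close>. These
  form a complete lattice under the pointwise order. The jump at the origin does not destroy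
  monotonicity because \<open>g\<close> never exceeds \<open>b\<close>.
\<close>

lemma ex_increasing_solution:
  assumes "a \<le> b" and g_mono: "mono_on {a..b} g" and g_range: "g ` {a..b} \<subseteq> {a..b}"
  shows "\<exists>P. increasing_solution h w g a b P"
proof -
  define T where "T P x = (if x < 0 then g (avg h w P x) else b)" for P and x :: real
  define K where "K = {P :: real \<Rightarrow> real. mono P \<and> (\<forall>x. P x \<in> {a..b}) \<and> (\<forall>x\<ge>0. P x = b)}"
  have T_in: "T P \<in> K" if "P \<in> K" for P
  proof -
    have P: "mono P" "\<And>x. P x \<in> {a..b}" using that by (auto simp: K_def)
    have A: "avg h w P x \<in> {a..b}" for x using avg_in_range[OF P] .
    have ran: "T P x \<in> {a..b}" for x
      using subsetD[OF g_range imageI[OF A[of x]]] \<open>a \<le> b\<close> by (simp add: T_def)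
    have "T P x \<le> T P y" if "x \<le> y" for x y
    proof (cases "y < 0")
      case True
      have "avg h w P x \<le> avg h w P y"
        using P(1) \<open>x \<le> y\<close> by (intro avg_mono) (auto simp: mono_def)
      then have "g (avg h w P x) \<le> g (avg h w P y)"
        using A by (intro mono_onD[OF g_mono])
      then show ?thesis using True \<open>x \<le> y\<close> by (simp add: T_def)
    next
      case False
      then have "T P y = b" by (simp add: T_def)
      then show ?thesis using ran[of x] by simp
    qed
    then show ?thesis using ran by (simp add: K_def mono_def) (simp add: T_def)
  qed
  have T_mono: "T P x \<le> T R x" if "P \<in> K" "R \<in> K" "\<And>y. P y \<le> R y" for P R x
  proof -
    have "avg h w P x \<le> avg h w R x"
      using that by (intro avg_mono) (auto simp: K_def)
    moreover have "avg h w P x \<in> {a..b}" "avg h w R x \<in> {a..b}"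
      using that by (auto simp: K_def intro!: avg_in_range simp del: atLeastAtMost_iff)
    ultimately show ?thesis using mono_onD[OF g_mono] by (simp add: T_def)
  qed
  define S where "S = {P \<in> K. \<forall>x. P x \<le> T P x}"
  define Q where "Q x = (SUP P\<in>S. P x)" for x
  \<comment> \<open>The smallest candidate lies below its image, so the supremum is over a nonempty set.\<close>
  have step: "(\<lambda>x. if x < 0 then a else b) \<in> K"
    using \<open>a \<le> b\<close> by (auto simp: K_def mono_def)
  have "(if x < 0 then a else b) \<le> T (\<lambda>x. if x < 0 then a else b) x" for x
  proof -
    have "T (\<lambda>x. if x < 0 then a else b) x \<in> {a..b}" using T_in[OF step] by (auto simp: K_def)
    then show ?thesis by (auto simp: T_def)
  qed
  then have "(\<lambda>x. if x < 0 then a else b) \<in> S" using step by (auto simp: S_def)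
  then have S_ne: "S \<noteq> {}" by blast
  have S_bd: "P x \<in> {a..b}" if "P \<in> S" for P x
    using that by (auto simp: S_def K_def)
  have bdd: "bdd_above ((\<lambda>P. P x) ` S)" for x
    using S_bd[of _ x] by (intro bdd_aboveI[of _ b]) auto
  have upper: "P x \<le> Q x" if "P \<in> S" for P x
    unfolding Q_def using that bdd by (intro cSUP_upper)
  have least: "Q x \<le> u" if "\<And>P. P \<in> S \<Longrightarrow> P x \<le> u" for x u
    unfolding Q_def using that S_ne by (intro cSUP_least)
  obtain P0 where P0: "P0 \<in> S" using S_ne by blast
  have Q_in: "Q \<in> K"
  proof -
    have "Q x \<le> Q y" if "x \<le> y" for x y
    proof (rule least)
      fix P assume P: "P \<in> S"
      then have "P x \<le> P y" using \<open>x \<le> y\<close> by (auto simp: S_def K_def mono_def)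
      then show "P x \<le> Q y" using upper[OF P, of y] by simp
    qed
    moreover have Qr: "Q x \<in> {a..b}" for x
      using upper[OF P0, of x] S_bd[OF P0, of x] least[of x b] S_bd[of _ x] by auto
    moreover have "Q x = b" if "x \<ge> 0" for x
      using upper[OF P0, of x] P0 that Qr[of x] by (auto simp: S_def K_def)
    ultimately show ?thesis by (auto simp: K_def mono_def)
  qed
  have sub: "Q x \<le> T Q x" for x
  proof (rule least)
    fix P assume P: "P \<in> S"
    have "P x \<le> T P x" using P by (simp add: S_def)
    also have "\<dots> \<le> T Q x"
      using P Q_in upper[OF P] by (intro T_mono) (auto simp: S_def)
    finally show "P x \<le> T Q x" .
  qed
  \<comment> \<open>Applying the monotone \<open>T\<close> to \<open>Q \<le> T Q\<close> shows that \<open>T Q\<close> is a competitor in the supremum.\<close>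
  have "T Q \<in> S"
    using T_in[OF Q_in] T_mono[OF Q_in T_in[OF Q_in] sub] by (simp add: S_def)
  then have "T Q x = Q x" for x
    using upper sub by (intro antisym)
  then have "Q x = g (avg h w Q x)" if "x < 0" for x
    using that by (metis T_def)
  then show ?thesis using Q_in by (auto simp: increasing_solution_def K_def)
qed

text \<open>
  The exponential weight makes the supremum norm of the difference of two solutions contract by
  the factor \<open>1 / 2\<close>. The weighted difference is bounded because the weight is at most \<open>1\<close> on
  \<open>x < 0\<close> and the solutions agree on \<open>x \<ge> 0\<close>.
\<close>

lemma increasing_solution_unique:
  assumes P: "increasing_solution h w g a b P" and R: "increasing_solution h w g a b R"
    and "L-lipschitz_on {a..b} g"
  shows "P = R"
proof -
  have monoP: "mono P" and ranP: "\<And>x. P x \<in> {a..b}"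
    and monoR: "mono R" and ranR: "\<And>x. R x \<in> {a..b}"
    using P R by (auto simp: increasing_solution_def)
  have W: "0 \<le> W" using w_nonneg[of 0] w_le[of 0] by simp
  have L: "0 \<le> L" using assms(3) by (rule lipschitz_on_nonneg)
  \<comment> \<open>The product \<open>L * W / c\<close> is the contraction factor; the summand \<open>1\<close> keeps \<open>c\<close> positive when
     \<open>L * W = 0\<close>.\<close>
  define c where "c = 2 * L * W + 1"
  have LW: "0 \<le> L * W" using L W by simp
  then have c_pos: "c > 0" by (simp add: c_def)
  then have c: "c > 0" "L * (W / c) \<le> 1 / 2"
    by (simp_all add: divide_le_eq) (simp add: c_def)
  define d where "d x = \<bar>P x - R x\<bar> * exp (c * x)" for x
  have d_le: "d x \<le> b - a" for x
  proof (cases "x < 0")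
    case True
    have "\<bar>P x - R x\<bar> \<le> b - a" using ranP[of x] ranR[of x] unfolding atLeastAtMost_iff by linarith
    moreover have "exp (c * x) \<le> 1" using True c(1) by (simp add: mult_pos_neg less_imp_le)
    ultimately show ?thesis
      unfolding d_def using mult_mono[of "\<bar>P x - R x\<bar>" "b - a" "exp (c * x)" 1] by simp
  next
    case False
    then have "d x = 0" using P R by (simp add: d_def increasing_solution_def)
    moreover have "a \<le> b" using ranP[of x] by simp
    ultimately show ?thesis by simp
  qed
  define M where "M = (SUP x. d x)"
  have d_M: "d x \<le> M" for x
    unfolding M_def using d_le by (intro cSUP_upper bdd_aboveI[of _ "b - a"]) auto
  have M0: "0 \<le> M" using d_M[of 0] by (rule order_trans[rotated]) (simp add: d_def)
  have bound: "\<bar>P y - R y\<bar> \<le> M * exp (- c * y)" for y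
  proof -
    have "\<bar>P y - R y\<bar> = d y * exp (- c * y)"
      by (simp add: d_def mult.assoc flip: exp_add)
    also have "\<dots> \<le> M * exp (- c * y)" using d_M[of y] by (rule mult_right_mono) simp
    finally show ?thesis .
  qed
  have "d x \<le> M / 2" for x
  proof (cases "x < 0")
    case True
    have "\<bar>P x - R x\<bar> = dist (g (avg h w P x)) (g (avg h w R x))"
      using P R True by (simp add: increasing_solution_def dist_real_def)
    also have "\<dots> \<le> L * \<bar>avg h w P x - avg h w R x\<bar>"
      using lipschitz_onD[OF assms(3) avg_in_range[OF monoP ranP] avg_in_range[OF monoR ranR]]
      by (simp add: dist_real_def)
    also have "\<dots> \<le> L * (W / c * (M * exp (- c * x)))"
      using L by (intro mult_left_mono avg_diff_le_exponential monoP monoR c M0 bound)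
    also have "\<dots> = L * (W / c) * (M * exp (- c * x))" by simp
    also have "\<dots> \<le> 1 / 2 * (M * exp (- c * x))"
      using M0 by (intro mult_right_mono c) auto
    finally have "d x \<le> 1 / 2 * (M * exp (- c * x)) * exp (c * x)"
      unfolding d_def by (rule mult_right_mono) simp
    then show ?thesis by (simp add: mult.assoc flip: exp_add)
  next
    case False
    then show ?thesis using P R M0 by (simp add: d_def increasing_solution_def)
  qed
  then have "M \<le> M / 2" unfolding M_def by (intro cSUP_least) auto
  then have "M = 0" using M0 by simp
  then show ?thesis using bound by (intro ext) simp
qed

text \<open>
  The limit \<open>l\<close> at \<open>-\<infinity>\<close> exists by monotonicity. The average has the same limit, since it lies between
  the values at the two ends of a window of fixed length, and continuity of \<open>g\<close> turns the equation
  into \<open>g l = l\<close>.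
\<close>

lemma increasing_solution_tendsto_at_bot:
  assumes P: "increasing_solution h w g a b P" and lip: "L-lipschitz_on {a..b} g"
    and fix_unique: "\<And>y. y \<in> {a..b} \<Longrightarrow> g y = y \<Longrightarrow> y = a"
  shows "(P \<longlongrightarrow> a) at_bot"
proof -
  have mono: "mono P" and ran: "\<And>x. P x \<in> {a..b}"
    using P by (auto simp: increasing_solution_def)
  define l where "l = (INF x. P x)"
  have bdd: "bdd_below (range P)" using ran by (intro bdd_belowI[of _ a]) auto
  have l_le: "l \<le> P x" for x unfolding l_def using bdd by (intro cINF_lower) auto
  have "a \<le> l" unfolding l_def using ran by (intro cINF_greatest) auto
  moreover have "l \<le> b" using l_le[of 0] ran[of 0] by simp
  ultimately have l: "l \<in> {a..b}" by simp
  have lim: "(P \<longlongrightarrow> l) at_bot"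
  proof (rule decreasing_tendsto)
    show "\<forall>\<^sub>F x in at_bot. l \<le> P x" using l_le by simp
    fix u assume "l < u"
    then obtain z where "P z < u" using bdd by (auto simp: l_def cInf_less_iff)
    then have "P x < u" if "x \<le> z" for x using monoD[OF mono that] by simp
    then show "\<forall>\<^sub>F x in at_bot. P x < u" by (auto simp: eventually_at_bot_linorder)
  qed
  have "filterlim (\<lambda>x. x + h) at_bot at_bot"
    unfolding filterlim_at_bot eventually_at_bot_linorder
    by (metis le_diff_eq)
  then have lim_shift: "((\<lambda>x. P (x + h)) \<longlongrightarrow> l) at_bot"
    by (rule filterlim_compose[OF lim])
  have "((\<lambda>x. avg h w P x) \<longlongrightarrow> l) at_bot"
    by (rule tendsto_sandwich[OF _ _ lim lim_shift]) (simp_all add: avg_between_endpoint_values mono)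
  from continuous_on_tendsto_compose[OF lipschitz_on_continuous_on[OF lip] this l]
  have "((\<lambda>x. g (avg h w P x)) \<longlongrightarrow> g l) at_bot"
    using avg_in_range[OF mono ran] by simp
  moreover have "\<forall>\<^sub>F x in at_bot. g (avg h w P x) = P x"
    by (rule eventually_mono[OF eventually_gt_at_bot[of 0]])
      (use P in \<open>simp add: increasing_solution_def\<close>)
  ultimately have "(P \<longlongrightarrow> g l) at_bot" by (rule Lim_transform_eventually)
  then have "g l = l" by (rule tendsto_unique[OF trivial_limit_at_bot_linorder _ lim])
  then show ?thesis using fix_unique[OF l] lim by simp
qed

end

section \<open>The velocity and the flux\<close>

lemma strict_antimono_velocity:
  assumes "\<forall>\<rho>\<in>{0..1}. (v has_real_derivative v' \<rho>) (at \<rho> within {0..1})"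
    and "\<forall>\<rho>\<in>{0..1}. v' \<rho> < 0" and "0 \<le> x" "x < y" "y \<le> 1"
  shows "v y < v x"
proof (rule DERIV_neg_imp_decreasing_open[OF \<open>x < y\<close>])
  have "continuous_on {0..1} v" using assms(1) by (auto intro: DERIV_continuous_on)
  then show "continuous_on {x..y} v" using assms by (auto elim: continuous_on_subset)
  fix z assume "x < z" "z < y"
  then have "(v has_real_derivative v' z) (at z)" "v' z < 0"
    using assms(1,2)[rule_format, of z] assms(3-) at_within_Icc_at[of 0 z 1] by auto
  then show "\<exists>l. (v has_real_derivative l) (at z) \<and> l < 0" by blast
qed

lemma ex_lipschitz_of_continuous_derivative:
  fixes f f' :: "real \<Rightarrow> real"
  assumes "\<forall>x\<in>{a..b}. (f has_real_derivative f' x) (at x within {a..b})" and "continuous_on {a..b} f'"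
  shows "\<exists>L. L-lipschitz_on {a..b} f"
proof -
  have "bounded (f' ` {a..b})"
    using assms(2) by (intro compact_imp_bounded compact_continuous_image) auto
  then obtain B where B: "B > 0" "\<And>x. x \<in> {a..b} \<Longrightarrow> norm (f' x) \<le> B"
    by (auto simp: bounded_pos)
  have "B-lipschitz_on {a..b} f"
    using B field_differentiable_bound[of "{a..b}" f f' B] assms(1)
    by (intro lipschitz_onI) (auto simp: dist_norm)
  then show ?thesis ..
qed

text \<open>
  Applied to \<open>f = v\<close>, this gives the Lipschitz bound for the map that sends an average to the density
  solving the profile equation.
\<close>

lemma lipschitz_on_const_divide:
  fixes f :: "real \<Rightarrow> real"
  assumes f: "L-lipschitz_on S f" and "m > 0" and le: "\<And>x. x \<in> S \<Longrightarrow> m \<le> f x" and "k \<ge> 0"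
  shows "(k * L / m\<^sup>2)-lipschitz_on S (\<lambda>x. k / f x)"
proof (rule lipschitz_onI)
  have L: "0 \<le> L" using f by (rule lipschitz_on_nonneg)
  then show "0 \<le> k * L / m\<^sup>2" using assms by simp
  fix x y assume xy: "x \<in> S" "y \<in> S"
  have pos: "0 < f x" "0 < f y" using le[OF xy(1)] le[OF xy(2)] \<open>m > 0\<close> by auto
  have "dist (k / f x) (k / f y) = k * \<bar>f x - f y\<bar> / (f x * f y)"
  proof -
    have "k / f x - k / f y = k * (f y - f x) / (f x * f y)"
      using pos by (simp add: field_simps)
    then show ?thesis using pos \<open>k \<ge> 0\<close> by (simp add: dist_real_def abs_mult abs_minus_commute)
  qed
  also have "\<dots> \<le> k * (L * dist x y) / (m\<^sup>2)"
  proof (rule frac_le)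
    show "k * \<bar>f x - f y\<bar> \<le> k * (L * dist x y)"
      using lipschitz_onD[OF f xy] \<open>k \<ge> 0\<close> by (intro mult_left_mono) (auto simp: dist_real_def)
    show "m\<^sup>2 \<le> f x * f y"
      using le xy \<open>m > 0\<close> pos unfolding power2_eq_square by (intro mult_mono) auto
  qed (use L \<open>k \<ge> 0\<close> \<open>m > 0\<close> in auto)
  finally show "dist (k / f x) (k / f y) \<le> k * L / m\<^sup>2 * dist x y" by simp
qed

lemma flux_strict_mono_below_critical_point:
  assumes "flux_critical_point v r" "\<kappa> > 0" "0 \<le> x" "x < y" "y \<le> r"
  shows "flux v \<kappa> x < flux v \<kappa> y"
proof -
  have "r < 1" using assms(1) by (simp add: flux_critical_point_def)
  obtain f' where der: "\<forall>\<rho>\<in>{0..1}. (flux v \<kappa> has_real_derivative f' \<rho>) (at \<rho> within {0..1})"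
    and pos: "\<forall>\<rho>\<in>{0..<r}. f' \<rho> > 0"
    using assms(1,2) by (auto simp: flux_critical_point_def simp del: atLeastAtMost_iff)
  show ?thesis
  proof (rule DERIV_pos_imp_increasing_open[OF \<open>x < y\<close>])
    have "continuous_on {0..1} (flux v \<kappa>)" using der by (intro DERIV_continuous_on) blast
    then show "continuous_on {x..y} (flux v \<kappa>)"
      using assms \<open>r < 1\<close> by (auto elim: continuous_on_subset)
    fix z assume "x < z" "z < y"
    then have "(flux v \<kappa> has_real_derivative f' z) (at z)" "f' z > 0"
      using der[rule_format, of z] pos[rule_format, of z] assms(3-) \<open>r < 1\<close> at_within_Icc_at[of 0 z 1] by auto
    then show "\<exists>l. (flux v \<kappa> has_real_derivative l) (at z) \<and> l > 0" by blast
  qed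
qed

section \<open>Stationary profiles\<close>

lemma avg_cong_off_zero:
  assumes "\<And>x. x \<noteq> 0 \<Longrightarrow> P x = Q x"
  shows "avg h w P x = avg h w Q x"
  unfolding avg_def by (rule integral_spike[of "{0}"]) (use assms in auto)

text \<open>
  A decreasing profile would stay above its value \<open>\<rho>p\<close> at \<open>1\<close> on the whole negative axis, which the
  smaller limit \<open>\<rho>m\<close> at \<open>-\<infinity>\<close> excludes.
\<close>

lemma profile_imp_mono_on:
  assumes "stationary_monotone_profile h \<kappa>m \<kappa>p v w fbar Q"
    and "Q 1 = \<rho>p" and "(Q \<longlongrightarrow> \<rho>m) at_bot" and "\<rho>m < \<rho>p"
  shows "mono_on (- {0}) Q"
proof (rule ccontr)
  assume "\<not> mono_on (- {0}) Q"
  then have "antimono_on (- {0}) Q" using assms(1) by (auto simp: stationary_monotone_profile_def)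
  then have "\<rho>p \<le> Q x" if "x < 0" for x
    using that assms(2) monotone_onD[of "- {0}" "(\<le>)" "(\<ge>)" Q x 1] by auto
  then have "\<forall>\<^sub>F x in at_bot. \<rho>p \<le> Q x"
    by (rule eventually_mono[OF eventually_gt_at_bot[of 0]]) auto
  then have "\<rho>p \<le> \<rho>m" using assms(3) by (intro tendsto_lowerbound[of Q]) auto
  then show False using \<open>\<rho>m < \<rho>p\<close> by simp
qed

theorem theorem2p4:
  fixes h \<kappa>m \<kappa>p \<rho>m \<rho>p \<rho>hat fbar :: real
    and v v' v'' w :: "real \<Rightarrow> real"
  assumes "h > 0" and "\<kappa>m > 0" and "\<kappa>p > 0"
    and "C2_unit v v' v''" and "v 0 = 1" and "v 1 = 0"
    and "\<forall>\<rho>\<in>{0..1}. v' \<rho> < 0" and "\<forall>\<rho>\<in>{0..1}. v'' \<rho> \<le> 0"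
    and "\<forall>x\<ge>0. w x \<ge> 0"
    and "continuous_on {0<..} w" and "bounded (w ` {0<..})"
    and "(w has_integral 1) {0..h}"
    and "\<forall>x\<ge>h. w x = 0"
    and "\<forall>x\<in>{0<..<h}. w differentiable (at x) \<and> deriv w x < 0"
    and "flux_critical_point v \<rho>hat"
    and "\<kappa>m > \<kappa>p"
    and "\<rho>m \<in> {0..1}" and "\<rho>p \<in> {0..1}"
    and "\<rho>m < \<rho>p" and "\<rho>p \<le> \<rho>hat"
    and "flux v \<kappa>m \<rho>m = fbar" and "flux v \<kappa>p \<rho>p = fbar"
  shows "\<exists>!Q. stationary_monotone_profile h \<kappa>m \<kappa>p v w fbar Q \<and>
              mono_on {..<0} Q \<and>
              (\<forall>x>0. Q x = \<rho>p) \<and>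
              (Q \<longlongrightarrow> \<rho>m) at_bot"
proof -
  \<comment> \<open>The weight is bounded on \<open>x > 0\<close> only; including its value at \<open>0\<close> gives a bound on the
     closed window of integration.\<close>
  have "bounded (insert (w 0) (w ` {0<..}))" using assms(11) by simp
  then obtain W where "\<And>y. y \<in> insert (w 0) (w ` {0<..}) \<Longrightarrow> norm y \<le> W"
    unfolding bounded_iff by blast
  then have "w s \<le> W" if "0 \<le> s" for s
    using that by (cases "s = 0") (force simp: abs_le_iff)+
  then interpret averaging_kernel h W w
    using assms(1,9,12) by unfold_locales auto

  have v_der: "\<forall>\<rho>\<in>{0..1}. (v has_real_derivative v' \<rho>) (at \<rho> within {0..1})"
    and v'_cont: "continuous_on {0..1} v'"
    using assms(4) by (auto simp: C2_unit_def intro: DERIV_continuous_on)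
  have v_less: "v y < v x" if "0 \<le> x" "x < y" "y \<le> 1" for x y
    using strict_antimono_velocity[OF v_der assms(7) that] .
  have p: "0 \<le> \<rho>m" "0 < \<rho>p" "\<rho>p < 1"
    using assms(15,17-20) by (auto simp: flux_critical_point_def)
  have vp: "0 < v \<rho>p" using v_less[of \<rho>p 1] p assms(6) by simp
  have v_ge: "v \<rho>p \<le> v y" if "y \<in> {\<rho>m..\<rho>p}" for y
    using v_less[of y \<rho>p] that p by (cases "y = \<rho>p") auto
  have fbar: "0 < fbar" using vp p assms(3,22) by (auto simp: flux_def)

  \<comment> \<open>The profile equation on \<open>x < 0\<close> solved for the density, as a function of the average.\<close>
  define g where "g y = fbar / \<kappa>m / v y" for y
  have g_eq: "g y = q \<longleftrightarrow> q * \<kappa>m * v y = fbar" if "y \<in> {\<rho>m..\<rho>p}" for y q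
    using v_ge[OF that] vp assms(2) by (auto simp: g_def field_simps)
  have g_mono: "mono_on {\<rho>m..\<rho>p} g"
  proof (rule mono_onI)
    fix x y assume xy: "x \<in> {\<rho>m..\<rho>p}" "y \<in> {\<rho>m..\<rho>p}" "x \<le> y"
    then have "v y \<le> v x" using v_less[of x y] p by (cases "x = y") auto
    then show "g x \<le> g y"
      unfolding g_def using v_ge[OF xy(2)] vp fbar assms(2) by (intro divide_left_mono) auto
  qed
  have g_m: "g \<rho>m = \<rho>m" using assms(19,21) by (subst g_eq) (auto simp: flux_def mult.commute)
  have g_p: "g \<rho>p \<le> \<rho>p"
  proof -
    have "g \<rho>p = \<rho>p * (\<kappa>p / \<kappa>m)" using assms(2,19,22) by (subst g_eq) (auto simp: flux_def)
    then show ?thesis using assms(2,16) p by (simp add: divide_le_eq mult_left_mono)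
  qed
  have g_range: "g ` {\<rho>m..\<rho>p} \<subseteq> {\<rho>m..\<rho>p}"
  proof (rule image_subsetI)
    fix y assume "y \<in> {\<rho>m..\<rho>p}"
    then show "g y \<in> {\<rho>m..\<rho>p}"
      using mono_onD[OF g_mono, of \<rho>m y] mono_onD[OF g_mono, of y \<rho>p] g_m g_p by simp
  qed
  have g_fix: "y = \<rho>m" if y: "y \<in> {\<rho>m..\<rho>p}" and "g y = y" for y
  proof (rule ccontr)
    assume "y \<noteq> \<rho>m"
    then have "flux v \<kappa>m \<rho>m < flux v \<kappa>m y"
      using flux_strict_mono_below_critical_point[OF assms(15,2) p(1), of y] y assms(20) by auto
    moreover have "flux v \<kappa>m y = fbar" using that g_eq[OF y] by (simp add: flux_def mult.commute)
    ultimately show False using assms(21) by simp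
  qed
  obtain L where "L-lipschitz_on {0..1} v"
    using ex_lipschitz_of_continuous_derivative[OF v_der v'_cont] by blast
  then have "L-lipschitz_on {\<rho>m..\<rho>p} v"
    using p by (auto elim: lipschitz_on_subset)
  then have g_lip: "(fbar / \<kappa>m * L / (v \<rho>p)\<^sup>2)-lipschitz_on {\<rho>m..\<rho>p} g"
    unfolding g_def using v_ge vp fbar assms(2) by (intro lipschitz_on_const_divide) auto

  obtain P where P: "increasing_solution h w g \<rho>m \<rho>p P"
    using ex_increasing_solution[OF _ g_mono g_range] assms(19) by auto
  show ?thesis
  proof (rule ex1I)
    let ?Q = "restrict P (- {0})"
    have P_in: "P x \<in> {\<rho>m..\<rho>p}" for x
      using P by (auto simp: increasing_solution_def)
    have mono: "mono P" and Ppos: "\<And>x. x > 0 \<Longrightarrow> P x = \<rho>p"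
      using P by (auto simp: increasing_solution_def)
    have avg: "avg h w ?Q x = avg h w P x" for x by (rule avg_cong_off_zero) auto
    have "P x * kappa \<kappa>m \<kappa>p x * v (avg h w P x) = fbar" if "x \<noteq> 0" for x
    proof (cases "x < 0")
      case True
      then have "g (avg h w P x) = P x" using P by (simp add: increasing_solution_def)
      moreover have "avg h w P x \<in> {\<rho>m..\<rho>p}"
        using P avg_in_range by (auto simp: increasing_solution_def)
      ultimately show ?thesis using True g_eq by (simp add: kappa_def)
    next
      case False
      then have "P x = \<rho>p" "P (x + h) = \<rho>p" using Ppos that h_pos by auto
      then have "avg h w P x = \<rho>p"
        using avg_between_endpoint_values[OF mono, of x] by simp
      then show ?thesis using False \<open>P x = \<rho>p\<close> assms(22) by (simp add: kappa_def flux_def mult.commute)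
    qed
    moreover have "P x \<in> {0..1}" for x using P_in[of x] p by simp
    then have "?Q \<in> (- {0}) \<rightarrow>\<^sub>E {0..1}" by simp
    moreover have "mono_on (- {0}) ?Q" using mono by (auto simp: mono_on_def mono_def)
    moreover have "mono_on {..<0} ?Q" using mono by (auto simp: mono_on_def mono_def)
    moreover have "(?Q \<longlongrightarrow> \<rho>m) at_bot"
    proof (rule Lim_transform_eventually)
      show "(P \<longlongrightarrow> \<rho>m) at_bot"
        using increasing_solution_tendsto_at_bot[OF P g_lip g_fix] .
      show "\<forall>\<^sub>F x in at_bot. P x = ?Q x"
        by (rule eventually_mono[OF eventually_gt_at_bot[of 0]]) auto
    qed
    ultimately show "stationary_monotone_profile h \<kappa>m \<kappa>p v w fbar ?Q \<and> mono_on {..<0} ?Q \<and>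
        (\<forall>x>0. ?Q x = \<rho>p) \<and> (?Q \<longlongrightarrow> \<rho>m) at_bot"
      using Ppos by (simp add: stationary_monotone_profile_def avg)
  next
    fix Q
    assume Q: "stationary_monotone_profile h \<kappa>m \<kappa>p v w fbar Q \<and> mono_on {..<0} Q \<and>
        (\<forall>x>0. Q x = \<rho>p) \<and> (Q \<longlongrightarrow> \<rho>m) at_bot"
    then have mono: "mono_on (- {0}) Q"
      using profile_imp_mono_on assms(19) by (metis zero_less_one)
    have lim: "(Q \<longlongrightarrow> \<rho>m) at_bot" and Qpos: "\<And>x. x > 0 \<Longrightarrow> Q x = \<rho>p" using Q by auto
    have eq: "Q x * kappa \<kappa>m \<kappa>p x * v (avg h w Q x) = fbar" if "x \<noteq> 0" for x
      using Q that by (simp add: stationary_monotone_profile_def)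
    \<comment> \<open>The value of \<open>Q\<close> at \<open>0\<close> is a convention that may break monotonicity across the origin.\<close>
    define R where "R = Q(0 := \<rho>p)"
    have avg: "avg h w R x = avg h w Q x" for x
      by (rule avg_cong_off_zero) (auto simp: R_def)
    have Q_le: "Q x \<le> \<rho>p" if "x < 0" for x
      using mono_onD[OF mono, of x 1] that Qpos[of 1] by auto
    have Q_ge: "\<rho>m \<le> Q x" if "x < 0" for x
    proof -
      have "\<forall>\<^sub>F y in at_bot. Q y \<le> Q x"
        using that by (intro eventually_mono[OF eventually_le_at_bot[of x]] mono_onD[OF mono]) auto
      then show ?thesis using lim by (intro tendsto_upperbound[of Q]) auto
    qed
    have R_mono: "mono R"
    proof (rule monoI)
      fix x y :: real assume "x \<le> y"
      then show "R x \<le> R y"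
        using mono_onD[OF mono, of x y] Q_le[of x] Qpos[of y] by (auto simp: R_def)
    qed
    have R_range: "R x \<in> {\<rho>m..\<rho>p}" for x
      using Q_le[of x] Q_ge[of x] Qpos[of x] assms(19)
      by (cases x "0::real" rule: linorder_cases) (auto simp: R_def)
    have "R x = g (avg h w R x)" if "x < 0" for x
    proof -
      have "R x * \<kappa>m * v (avg h w R x) = fbar"
        unfolding avg using eq[of x] that by (simp add: R_def kappa_def)
      then show ?thesis using g_eq[OF avg_in_range[OF R_mono R_range]] by metis
    qed
    then have "increasing_solution h w g \<rho>m \<rho>p R"
      using R_mono R_range Qpos by (auto simp: increasing_solution_def R_def)
    then have "R = P" using P g_lip by (rule increasing_solution_unique)
    then have "Q x = P x" if "x \<noteq> 0" for x using that by (auto simp: R_def)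
    moreover have "Q \<in> extensional (- {0})"
      using Q by (auto simp: stationary_monotone_profile_def PiE_def)
    ultimately show "Q = restrict P (- {0})"
      by (intro extensionalityI[of Q "- {0}"]) auto
  qed
qed

end
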